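(* Let $D\subseteq\mathbb{E}$ be such that $\delta=\{h(e):e\in D\}$ is a 1-connected set of plaquettes, and let $\overline\delta=\delta\cup\{h: h\text{ is a plaquette that is 1-connected to some member of }\delta\}$. For any finite connected component $C$ of the graph $(\mathbb{Z}^3,\mathbb{E}\setminus D)$, the graph $(\Delta_{\rm v}C,\Delta_{\rm e}C)$ is connected, where $\Delta_{\rm v}C$ is the set of all vertices $v$ of $C$ for which there exists $w\in\mathbb{Z}^3$ (adjacent to $v$ in $\mathbb{L}$) with $h(\langle v,w\rangle)\in\overline\delta$, and $\Delta_{\rm e}C$ is the set of edges $f$ of $C$ for which $h(f)\in\overline\delta\setminus\delta$.
   Context: $\mathbb{L}=(\mathbb{Z}^3,\mathbb{E})$ is the cubic lattice: there is an edge $\langle x,y\rangle$ iff $\sum_i|x_i-y_i|=1$. A plaquette is a closed unit square in $\mathbb{R}^3$ with corners in $\mathbb{Z}^3+(\frac12,\frac12,\frac12)$. For an edge $e=\langle x,y\rangle\in\mathbb{E}$, $h(e)$ is the unique plaquette through the middle of which the segment $xy$ passes. Distinct plaquettes $h_1,h_2$ are 1-connected if $h_1\cap h_2$ is homeomorphic to $[0,1]$; a set of plaquettes is 1-connected if it is connected as a graph with this adjacency relation. Edges in $\Delta_{\rm e}C$ have both endvertices in $\Delta_{\rm v}C$. *)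

theory Defs
  imports "HOL-Analysis.Analysis"
begin

text \<open>Undirected graphs are given by a vertex set \<open>V\<close> and a set \<open>E\<close> of two-element sets of vertices.\<close>

definition adj_rel :: "'a set \<Rightarrow> 'a set set \<Rightarrow> ('a \<times> 'a) set" where
  "adj_rel V E = {(x, y). x \<in> V \<and> y \<in> V \<and> {x, y} \<in> E}"

text \<open>The empty graph counts as connected.\<close>

definition connected_graph :: "'a set \<Rightarrow> 'a set set \<Rightarrow> bool" where
  "connected_graph V E \<longleftrightarrow> (\<forall>x\<in>V. \<forall>y\<in>V. (x, y) \<in> (adj_rel V E)\<^sup>*)"

text \<open>A component is represented by its vertex set; its edges are the members of \<open>E\<close> contained in it.\<close>

definition graph_components :: "'a set \<Rightarrow> 'a set set \<Rightarrow> 'a set set" where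
  "graph_components V E = {{y. (x, y) \<in> (adj_rel V E)\<^sup>*} | x. x \<in> V}"

definition lattice_edges :: "(int ^ 3) set set" where
  "lattice_edges = {{x, y} | x y. (\<Sum>i\<in>UNIV. \<bar>x $ i - y $ i\<bar>) = 1}"

definition real_point :: "int ^ 3 \<Rightarrow> real ^ 3" where
  "real_point x = (\<chi> i. real_of_int (x $ i))"

definition shifted_lattice :: "(real ^ 3) set" where
  "shifted_lattice = {real_point z + (\<chi> i. 1 / 2) | z. True}"

definition parallelogram :: "real ^ 3 \<Rightarrow> real ^ 3 \<Rightarrow> real ^ 3 \<Rightarrow> (real ^ 3) set" where
  "parallelogram a u v = {a + s *\<^sub>R u + t *\<^sub>R v | s t. s \<in> {0..1} \<and> t \<in> {0..1}}"

text \<open>\<open>plaquette_with_middle h c\<close>: the set \<open>h\<close> is a plaquette, and \<open>c\<close> is its middle, that is,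
  the midpoint of its diagonals.\<close>

definition plaquette_with_middle :: "(real ^ 3) set \<Rightarrow> real ^ 3 \<Rightarrow> bool" where
  "plaquette_with_middle h c \<longleftrightarrow>
     (\<exists>a u v. norm u = 1 \<and> norm v = 1 \<and> u \<bullet> v = 0 \<and>
        {a, a + u, a + v, a + u + v} \<subseteq> shifted_lattice \<and>
        h = parallelogram a u v \<and> c = midpoint a (a + u + v))"

definition plaquettes :: "(real ^ 3) set set" where
  "plaquettes = {h. \<exists>c. plaquette_with_middle h c}"

definition crosses_middle :: "(int ^ 3) set \<Rightarrow> (real ^ 3) set \<Rightarrow> bool" where
  "crosses_middle e h \<longleftrightarrow>
     (\<exists>x y c. e = {x, y} \<and> plaquette_with_middle h c \<and>
        c \<in> closed_segment (real_point x) (real_point y))"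

lemma shifted_lattice_iff: "a \<in> shifted_lattice \<longleftrightarrow> (\<exists>z::int^3. \<forall>i. a $ i = of_int (z $ i) + 1/2)"
  by (auto simp: shifted_lattice_def real_point_def vec_eq_iff)

lemma lattice_unit_vector:
  fixes u :: "real^3"
  assumes "a \<in> shifted_lattice" "a + u \<in> shifted_lattice" "norm u = 1"
  shows "\<exists>k s. (s = 1 \<or> s = -1) \<and> u = axis k s"
proof -
  obtain z w :: "int^3" where "\<forall>i. a $ i = of_int (z $ i) + 1/2" "\<forall>i. (a+u) $ i = of_int (w $ i) + 1/2"
    using assms shifted_lattice_iff by blast
  then have u: "u $ i = of_int (w $ i - z $ i)" for i
    by (smt (verit, best) of_int_diff vector_add_component)
  define d where "d i = w $ i - z $ i" for i
  have "(u $ 1)^2 + (u $ 2)^2 + (u $ 3)^2 = 1"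
    using assms(3) by (simp add: norm_vec_def L2_set_def sum_3)
  then have "real_of_int ((d 1)^2 + (d 2)^2 + (d 3)^2) = of_int 1"
    by (simp add: u d_def)
  then have s: "(d 1)^2 + (d 2)^2 + (d 3)^2 = 1" by (simp only: of_int_eq_iff)
  have "\<bar>d i\<bar> \<le> 1" for i
  proof (rule ccontr)
    assume "\<not> \<bar>d i\<bar> \<le> 1"
    then have "2\<^sup>2 \<le> \<bar>d i\<bar>\<^sup>2" by (intro power_mono) auto
    then have "4 \<le> (d i)\<^sup>2" by simp
    moreover have "(d i)\<^sup>2 \<le> (d 1)^2 + (d 2)^2 + (d 3)^2" using exhaust_3[of i] by auto
    ultimately show False using s by linarith
  qed
  then have d_bounds: "d i \<le> 1 \<and> -1 \<le> d i" for i
    by (simp add: abs_le_iff minus_le_iff)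
  have r: "d i = 0 \<or> d i = 1 \<or> d i = -1" for i
    using d_bounds[of i] by presburger
  have "(d 1)^2 = 1 \<and> d 2 = 0 \<and> d 3 = 0 \<or> d 1 = 0 \<and> (d 2)^2 = 1 \<and> d 3 = 0 \<or> d 1 = 0 \<and> d 2 = 0 \<and> (d 3)^2 = 1"
    using r[of 1] r[of 2] r[of 3] s by (elim disjE) simp_all
  then have "\<exists>k. (d k)^2 = 1 \<and> (\<forall>l. l \<noteq> k \<longrightarrow> d l = 0)"
    unfolding forall_3
    by (elim disjE) (rule exI[of _ 1], simp, rule exI[of _ 2], simp, rule exI[of _ 3], simp)
  then obtain k where k: "(d k)^2 = 1" "\<And>l. l \<noteq> k \<Longrightarrow> d l = 0" by blast
  have "u = axis k (of_int (d k))"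
    using k(2) by (simp add: vec_eq_iff axis_def u d_def)
  moreover have "real_of_int (d k) = 1 \<or> real_of_int (d k) = -1"
    using r[of k] k(1) by (elim disjE) simp_all
  ultimately show ?thesis by blast
qed

definition axis_square :: "3 \<Rightarrow> real^3 \<Rightarrow> (real^3) set" where
  "axis_square k c = {p. p $ k = c $ k \<and> (\<forall>l. l \<noteq> k \<longrightarrow> \<bar>p $ l - c $ l\<bar> \<le> 1/2)}"

definition half_odd :: "real \<Rightarrow> bool" where "half_odd r \<longleftrightarrow> (\<exists>z::int. r = of_int z + 1/2)"

lemma half_odd_not_Ints: "half_odd r \<Longrightarrow> r \<in> \<int> \<Longrightarrow> False"
proof -
  assume "half_odd r" "r \<in> \<int>"
  then obtain z w :: int where "of_int z + 1/2 = real_of_int w" unfolding half_odd_def by (metis Ints_cases)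
  then have "real_of_int (2*z+1) = of_int (2*w)" by simp
  then have "2*z+1 = 2*w" by (simp only: of_int_eq_iff)
  then show False by presburger
qed

lemma UNIV_3_distinct:
  assumes "i \<noteq> j" "i \<noteq> k" "j \<noteq> (k::3)"
  shows "UNIV = {i, j, k}"
  using assms by (intro card_subset_eq[symmetric]) auto

lemma all_3_distinct:
  assumes "i \<noteq> j" "i \<noteq> k" "j \<noteq> (k::3)"
  shows "(\<forall>l. P l) \<longleftrightarrow> P i \<and> P j \<and> P k"
  using UNIV_3_distinct[OF assms] by (metis UNIV_I empty_iff insert_iff)

lemma parallelogram_axis:
  assumes "i \<noteq> j" "i \<noteq> k" "j \<noteq> (k::3)" "s = 1 \<or> s = -1" "t = 1 \<or> t = -1"
    "c = midpoint a (a + axis i s + axis j t)"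
  shows "parallelogram a (axis i s) (axis j t) = axis_square k c"
proof -
  have all: "(\<forall>l. P l) \<longleftrightarrow> P i \<and> P j \<and> P k" for P
    using all_3_distinct[OF assms(1-3)] .
  have ne: "j \<noteq> i" "k \<noteq> i" "k \<noteq> j" using assms by auto
  have c: "c $ k = a $ k" "c $ i = a $ i + s/2" "c $ j = a $ j + t/2"
    using assms by (auto simp: midpoint_def axis_def field_simps)
  show ?thesis
  proof (rule set_eqI)
    fix p :: "real ^ 3"
    have side_i: "(p $ i - a $ i) * s \<in> {0..1} \<longleftrightarrow> \<bar>p $ i - c $ i\<bar> \<le> 1/2"
      unfolding c(2) atLeastAtMost_iff abs_le_iff using assms(4)
      by (elim disjE) (simp_all, linarith+)
    have side_j: "(p $ j - a $ j) * t \<in> {0..1} \<longleftrightarrow> \<bar>p $ j - c $ j\<bar> \<le> 1/2"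
      unfolding c(3) atLeastAtMost_iff abs_le_iff using assms(5)
      by (elim disjE) (simp_all, linarith+)
    have "p \<in> parallelogram a (axis i s) (axis j t) \<longleftrightarrow>
      (\<exists>x y. x \<in> {0..1} \<and> y \<in> {0..1} \<and> p $ i = a $ i + x * s \<and> p $ j = a $ j + y * t \<and> p $ k = a $ k)"
      unfolding parallelogram_def mem_Collect_eq vec_eq_iff all using assms(1-3) ne
      by (auto simp: axis_def)
    also have "\<dots> \<longleftrightarrow> ((p $ i - a $ i) * s \<in> {0..1} \<and> (p $ j - a $ j) * t \<in> {0..1} \<and> p $ k = a $ k)"
      (is "?L = ?R")
    proof
      assume ?R then show ?L using assms(4,5)
        by (intro exI[of _ "(p $ i - a $ i) * s"] exI[of _ "(p $ j - a $ j) * t"]) auto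
    qed (use assms(4,5) in auto)
    also have "\<dots> \<longleftrightarrow> p \<in> axis_square k c"
      unfolding axis_square_def mem_Collect_eq all using ne c(1) side_i side_j by auto
    finally show "p \<in> parallelogram a (axis i s) (axis j t) \<longleftrightarrow> p \<in> axis_square k c" .
  qed
qed

lemma third_index: assumes "i \<noteq> (j::3)" obtains k where "i \<noteq> k" "j \<noteq> k"
proof -
  have "1 \<noteq> (2::3)" "1 \<noteq> (3::3)" "2 \<noteq> (3::3)" by auto
  then show ?thesis using that exhaust_3[of i] exhaust_3[of j] by metis
qed

lemma plaquette_with_middle_iff:
  "plaquette_with_middle h c \<longleftrightarrow>
     (\<exists>k. half_odd (c $ k) \<and> (\<forall>l. l \<noteq> k \<longrightarrow> c $ l \<in> \<int>) \<and> h = axis_square k c)"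
proof
  assume "plaquette_with_middle h c"
  then obtain a u v where h: "norm u = 1" "norm v = 1" "u \<bullet> v = 0" 
    "a \<in> shifted_lattice" "a + u \<in> shifted_lattice" "a + v \<in> shifted_lattice"
    "h = parallelogram a u v" "c = midpoint a (a + u + v)" unfolding plaquette_with_middle_def by blast
  obtain i s where i: "s = 1 \<or> s = -1" "u = axis i s" using lattice_unit_vector h by metis
  obtain j t where j: "t = 1 \<or> t = -1" "v = axis j t" using lattice_unit_vector h by metis
  have ij: "i \<noteq> j" using h(3) i j by (auto simp: inner_axis_axis)
  obtain k where k: "i \<noteq> k" "j \<noteq> k" using third_index ij by blast
  have hs: "h = axis_square k c" using parallelogram_axis[OF ij k i(1) j(1)] h i j by auto
  obtain z :: "int^3" where z: "\<forall>i. a $ i = of_int (z $ i) + 1/2" using h shifted_lattice_iff by blast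
  have ck: "c $ k = a $ k" "c $ i = a $ i + s/2" "c $ j = a $ j + t/2"
    using h i j ij k by (auto simp: midpoint_def axis_def field_simps)
  have "half_odd (c $ k)" using ck z half_odd_def by auto
  moreover have "c $ i \<in> \<int>" "c $ j \<in> \<int>" using ck z i(1) j(1) by auto
  moreover have "l = i \<or> l = j \<or> l = k" for l
    using UNIV_3_distinct[OF ij k] by auto
  ultimately show "\<exists>k. half_odd (c $ k) \<and> (\<forall>l. l \<noteq> k \<longrightarrow> c $ l \<in> \<int>) \<and> h = axis_square k c" using hs by metis
next
  assume "\<exists>k. half_odd (c $ k) \<and> (\<forall>l. l \<noteq> k \<longrightarrow> c $ l \<in> \<int>) \<and> h = axis_square k c"
  then obtain k where k: "half_odd (c $ k)" "\<And>l. l \<noteq> k \<Longrightarrow> c $ l \<in> \<int>" "h = axis_square k c" by blast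
  have "1 \<noteq> (2::3)" "1 \<noteq> (3::3)" "2 \<noteq> (3::3)" by auto
  then obtain i j where ij: "i \<noteq> j" "i \<noteq> k" "j \<noteq> k" using exhaust_3[of k] by metis
  define a where "a = c - (1/2) *\<^sub>R (axis i 1 + axis j 1)"
  have all: "(\<forall>l. P l) \<longleftrightarrow> P i \<and> P j \<and> P k" for P
    using all_3_distinct[OF ij] .
  have sh: "p \<in> shifted_lattice \<longleftrightarrow> (\<forall>l. half_odd (p $ l))" for p
  proof
    assume "\<forall>l. half_odd (p $ l)"
    then obtain z where "\<forall>l. p $ l = real_of_int (z l) + 1/2" unfolding half_odd_def by metis
    then show "p \<in> shifted_lattice" unfolding shifted_lattice_iff by (intro exI[of _ "\<chi> l. z l"]) simp
  qed (auto simp: shifted_lattice_iff half_odd_def)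
  have hi: "half_odd (x - 1/2)" "half_odd (x + 1/2)" if xi: "x \<in> \<int>" for x
  proof -
    obtain z where z: "x = of_int z" using xi by (elim Ints_cases)
    show "half_odd (x - 1/2)" unfolding half_odd_def using z by (intro exI[of _ "z-1"]) simp
    show "half_odd (x + 1/2)" unfolding half_odd_def using z by (intro exI[of _ z]) simp
  qed
  have m: "c = midpoint a (a + axis i 1 + axis j 1)" by (simp add: a_def midpoint_def vec_eq_iff field_simps)
  have "{a, a + axis i 1, a + axis j 1, a + axis i 1 + axis j 1} \<subseteq> shifted_lattice"
    unfolding insert_subset sh all using ij k(1) hi k(2)[of i] k(2)[of j] by (auto simp: a_def axis_def algebra_simps)
  moreover have "h = parallelogram a (axis i 1) (axis j 1)"
    using k(3) parallelogram_axis[OF ij _ _ m] by simp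
  moreover have "axis i (1::real) \<bullet> axis j 1 = 0" using ij by (simp add: inner_axis_axis)
  ultimately show "plaquette_with_middle h c"
    unfolding plaquette_with_middle_def using m norm_axis_1 by blast
qed

lemma plaquette_of_ex1:
  assumes "e \<in> lattice_edges"
  shows "\<exists>!h. h \<in> plaquettes \<and> crosses_middle e h"
proof -
  obtain x y :: "int^3" where e: "e = {x,y}" "(\<Sum>i\<in>UNIV. \<bar>x $ i - y $ i\<bar>) = 1"
    using assms unfolding lattice_edges_def mem_Collect_eq by (elim exE conjE)
  then have s: "\<bar>x $ 1 - y $ 1\<bar> + \<bar>x $ 2 - y $ 2\<bar> + \<bar>x $ 3 - y $ 3\<bar> = 1" by (simp add: sum_3)
  obtain m where m: "\<And>l. l \<noteq> m \<Longrightarrow> x $ l = y $ l" "x $ m = y $ m + 1 \<or> y $ m = x $ m + 1"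
  proof -
    have "\<exists>m. (\<forall>l. l \<noteq> m \<longrightarrow> x $ l = y $ l) \<and> (x $ m = y $ m + 1 \<or> y $ m = x $ m + 1)"
    proof -
      have split: "p = 1 \<and> q = 0 \<and> r = 0 \<or> p = 0 \<and> q = 1 \<and> r = 0 \<or> p = 0 \<and> q = 0 \<and> r = 1"
        if "0 \<le> p" "0 \<le> q" "0 \<le> r" "p + q + r = 1" for p q r :: int
        using that by (smt (verit))
      consider "x $ 1 = y $ 1" "x $ 2 = y $ 2" "\<bar>x $ 3 - y $ 3\<bar> = 1"
        | "x $ 1 = y $ 1" "x $ 3 = y $ 3" "\<bar>x $ 2 - y $ 2\<bar> = 1"
        | "x $ 3 = y $ 3" "x $ 2 = y $ 2" "\<bar>x $ 1 - y $ 1\<bar> = 1"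
        using split[OF abs_ge_zero abs_ge_zero abs_ge_zero s] by (elim disjE conjE) simp_all
      then show ?thesis
      proof cases
        case 1 then show ?thesis unfolding forall_3 by (intro exI[of _ 3]) auto
      next
        case 2 then show ?thesis unfolding forall_3 by (intro exI[of _ 2]) auto
      next
        case 3 then show ?thesis unfolding forall_3 by (intro exI[of _ 1]) auto
      qed
    qed
    then show ?thesis using that by blast
  qed
  define c where "c = midpoint (real_point x) (real_point y)"
  have cl: "c $ l = of_int (x $ l)" if "l \<noteq> m" for l using m(1)[OF that] by (simp add: c_def midpoint_def real_point_def)
  have cm: "c $ m = (of_int (x $ m) + of_int (y $ m))/2" by (simp add: c_def midpoint_def real_point_def)
  have hm: "half_odd (c $ m)" using m(2) cm unfolding half_odd_def 
    by (auto intro!: exI[of _ "min (x $ m) (y $ m)"])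
  have P: "plaquette_with_middle (axis_square m c) c" unfolding plaquette_with_middle_iff using cl hm by auto
  have c1: "crosses_middle e (axis_square m c)" unfolding crosses_middle_def using e P c_def by (metis midpoint_in_closed_segment)
  have "h = axis_square m c" if ch: "crosses_middle e h" for h
  proof -
    obtain x' y' d where d: "e = {x',y'}" "plaquette_with_middle h d" "d \<in> closed_segment (real_point x') (real_point y')"
      using ch unfolding crosses_middle_def by (elim exE conjE)
    have ds: "d \<in> closed_segment (real_point x) (real_point y)"
      using d e by (metis closed_segment_commute doubleton_eq_iff)
    then obtain u where u: "0 \<le> u" "u \<le> 1" "d = (1-u) *\<^sub>R real_point x + u *\<^sub>R real_point y" by (auto simp: closed_segment_def)
    have dl: "d $ l = of_int (x $ l)" if "l \<noteq> m" for l using m(1)[OF that] by (simp add: u real_point_def algebra_simps)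
    obtain k where k: "half_odd (d $ k)" "h = axis_square k d" using d(2) plaquette_with_middle_iff by blast
    have km: "k = m" using dl k(1) half_odd_not_Ints by (metis Ints_of_int)
    obtain z where z: "d $ m = of_int z + 1/2" using k km half_odd_def by auto
    have dm: "d $ m = (1-u) * of_int (x $ m) + u * of_int (y $ m)" by (simp add: u real_point_def)
    have "d $ m = c $ m"
    proof (cases "x $ m = y $ m + 1")
      case True
      then have "d $ m = of_int (y $ m) + (1 - u)" using dm by (simp add: algebra_simps)
      then have "of_int z + 1/2 = real_of_int (y $ m) + (1-u)" using z by simp
      then have "real_of_int z < of_int (y $ m + 1)" "real_of_int (y $ m) < of_int (z + 1)" using u by auto
      then have "z = y $ m" by (simp only: of_int_less_iff)
      then show ?thesis using z cm True by simp
    next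
      case False
      then have T: "y $ m = x $ m + 1" using m by auto
      then have "d $ m = of_int (x $ m) + u" using dm by (simp add: algebra_simps)
      then have "of_int z + 1/2 = real_of_int (x $ m) + u" using z by simp
      then have "real_of_int z < of_int (x $ m + 1)" "real_of_int (x $ m) < of_int (z + 1)" using u by auto
      then have "z = x $ m" by (simp only: of_int_less_iff)
      then show ?thesis using z cm T by simp
    qed
    then have "d = c" using dl cl by (metis vec_eq_iff)
    then show ?thesis using k km by simp
  qed
  moreover have "axis_square m c \<in> plaquettes" using P unfolding plaquettes_def by blast
  ultimately show ?thesis using c1 by blast
qed

definition plaquette_of :: "(int ^ 3) set \<Rightarrow> (real ^ 3) set" where
  "plaquette_of e = (THE h. h \<in> plaquettes \<and> crosses_middle e h)"

lemma plaquette_of: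
  assumes "e \<in> lattice_edges"
  shows "plaquette_of e \<in> plaquettes" "crosses_middle e (plaquette_of e)"
  using theI'[OF plaquette_of_ex1[OF assms]] unfolding plaquette_of_def by auto

definition one_connected :: "(real ^ 3) set \<Rightarrow> (real ^ 3) set \<Rightarrow> bool" where
  "one_connected h1 h2 \<longleftrightarrow>
     h1 \<in> plaquettes \<and> h2 \<in> plaquettes \<and> h1 \<noteq> h2 \<and> (h1 \<inter> h2) homeomorphic {0..1::real}"

definition one_connected_set :: "(real ^ 3) set set \<Rightarrow> bool" where
  "one_connected_set \<delta> \<longleftrightarrow>
     \<delta> \<subseteq> plaquettes \<and> connected_graph \<delta> {{h1, h2} | h1 h2. one_connected h1 h2}"

definition plaquette_closure :: "(real ^ 3) set set \<Rightarrow> (real ^ 3) set set" where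
  "plaquette_closure \<delta> = \<delta> \<union> {h \<in> plaquettes. \<exists>h'\<in>\<delta>. one_connected h h'}"

definition Delta_v :: "(int ^ 3) set set \<Rightarrow> (int ^ 3) set \<Rightarrow> (int ^ 3) set" where
  "Delta_v D C =
     {v \<in> C. \<exists>w. {v, w} \<in> lattice_edges \<and>
        plaquette_of {v, w} \<in> plaquette_closure (plaquette_of ` D)}"

definition Delta_e :: "(int ^ 3) set set \<Rightarrow> (int ^ 3) set \<Rightarrow> (int ^ 3) set set" where
  "Delta_e D C =
     {f \<in> lattice_edges - D. f \<subseteq> C \<and>
        plaquette_of f \<in> plaquette_closure (plaquette_of ` D) - plaquette_of ` D}"

lemma Delta_e_endpoints:
  assumes "f \<in> Delta_e D C" shows "f \<subseteq> Delta_v D C"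
proof -
  have f: "f \<in> lattice_edges" "f \<subseteq> C" "plaquette_of f \<in> plaquette_closure (plaquette_of ` D)"
    using assms by (auto simp: Delta_e_def)
  obtain x y where xy: "f = {x, y}" using f(1) unfolding lattice_edges_def by blast
  then have "f = {y, x}" by blast
  then have "x \<in> Delta_v D C" "y \<in> Delta_v D C"
    unfolding Delta_v_def mem_Collect_eq using f xy by (metis insert_subset)+
  then show ?thesis using xy by simp
qed

end

theory Submission
  imports Defs
begin

text \<open>
  The proof is a discrete version of the exactness of the Mayer--Vietoris sequence
  \<open>H\<^sup>0(U) \<oplus> H\<^sup>0(V) \<rightarrow> H\<^sup>0(U \<inter> V) \<rightarrow> H\<^sup>1(\<real>\<^sup>3) = 0\<close>, where \<open>U\<close> stands for \<open>C\<close> and \<open>V\<close> for a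
  connected region that contains \<open>\<delta>\<close>.  It shows that the overlap \<open>U \<inter> V\<close>, represented here by
  the graph \<open>(\<Delta>\<^sub>v C, \<Delta>\<^sub>e C)\<close>, is connected.

  The geometry enters only through the fact that two distinct plaquettes are 1-connected iff the
  edges they are dual to lie on a common unit square of the lattice
  (\<open>one_connected_plaquette_of_iff\<close>).  So \<open>D\<close> is connected through squares, and \<open>\<Delta>\<^sub>e C\<close> consists of
  the edges of \<open>C\<close> that lie on a square with some edge of \<open>D\<close>.

  Fix \<open>v \<in> \<Delta>\<^sub>v C\<close> and let \<open>f\<close> be the indicator function of the set of vertices that can be reached
  from \<open>v\<close> in \<open>(\<Delta>\<^sub>v C, \<Delta>\<^sub>e C)\<close>.  Let the 1-cochain \<open>\<phi>\<close> be the increment of \<open>f\<close> along the edges of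
  the graph \<open>C\<close>, and zero on all other edges.  It sums to zero around every square.  On a square
  without an edge of \<open>D\<close>, either all corners are in \<open>C\<close>, and the increments of \<open>f\<close> telescope, or
  none is, and \<open>\<phi>\<close> vanishes there.  On a square with an edge of \<open>D\<close> the cochain vanishes edge by
  edge, because those edges that belong to \<open>C\<close> are in \<open>\<Delta>\<^sub>e C\<close>, along which \<open>f\<close> does not change.
  By \<open>closed_lattice_cochain_exact\<close>, \<open>\<phi>\<close> is therefore the increment of a function \<open>g\<close> on the whole
  lattice.

  This \<open>g\<close> is constant on every square that meets \<open>D\<close>, and by connectedness of \<open>D\<close> its value is the
  same on all of them (\<open>square_invariant_const_on_one_connected\<close>); hence \<open>g\<close> is constant on
  \<open>\<Delta>\<^sub>v C\<close>.  On the other hand \<open>g - f\<close> does not change along the edges of \<open>C\<close>, so it is constant on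
  \<open>C\<close>.  Consequently \<open>f\<close> is constant on \<open>\<Delta>\<^sub>v C\<close>, with value \<open>f v = 1\<close>: everything is reachable.
\<close>

section \<open>Edges and unit squares of the cubic lattice\<close>

abbreviation unit_vec :: "'n \<Rightarrow> int ^ 'n" where
  "unit_vec i \<equiv> axis i 1"

definition lattice_edge :: "int ^ 3 \<Rightarrow> 3 \<Rightarrow> (int ^ 3) set" where
  "lattice_edge x i = {x, x + unit_vec i}"

definition square_edges :: "int ^ 3 \<Rightarrow> 3 \<Rightarrow> 3 \<Rightarrow> (int ^ 3) set set" where
  "square_edges z i j =
     {lattice_edge z i, lattice_edge z j,
      lattice_edge (z + unit_vec i) j, lattice_edge (z + unit_vec j) i}"

definition share_square :: "(int ^ 3) set \<Rightarrow> (int ^ 3) set \<Rightarrow> bool" where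
  "share_square e f \<longleftrightarrow> (\<exists>z i j. i \<noteq> j \<and> e \<in> square_edges z i j \<and> f \<in> square_edges z i j)"

lemma share_square_commute: "share_square e f \<longleftrightarrow> share_square f e"
  unfolding share_square_def by metis

lemma lattice_edges_iff: "e \<in> lattice_edges \<longleftrightarrow> (\<exists>x i. e = lattice_edge x i)"
proof
  assume "e \<in> lattice_edges"
  then obtain x y :: "int^3" where e: "e = {x, y}" "(\<Sum>i\<in>UNIV. \<bar>x $ i - y $ i\<bar>) = 1"
    unfolding lattice_edges_def by blast
  then have s: "\<bar>x $ 1 - y $ 1\<bar> + \<bar>x $ 2 - y $ 2\<bar> + \<bar>x $ 3 - y $ 3\<bar> = 1"
    by (simp add: sum_3)
  have "(\<exists>i. y = x + unit_vec i) \<or> (\<exists>i. x = y + unit_vec i)"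
  proof -
    have "\<exists>i. (y $ i = x $ i + 1 \<or> x $ i = y $ i + 1) \<and> (\<forall>l. l \<noteq> i \<longrightarrow> x $ l = y $ l)"
    proof -
      have "(y $ 1 = x $ 1 + 1 \<or> x $ 1 = y $ 1 + 1) \<and> x $ 2 = y $ 2 \<and> x $ 3 = y $ 3 \<or>
            (y $ 2 = x $ 2 + 1 \<or> x $ 2 = y $ 2 + 1) \<and> x $ 1 = y $ 1 \<and> x $ 3 = y $ 3 \<or>
            (y $ 3 = x $ 3 + 1 \<or> x $ 3 = y $ 3 + 1) \<and> x $ 1 = y $ 1 \<and> x $ 2 = y $ 2"
        using s by smt
      moreover have "(\<exists>i. R i) \<longleftrightarrow> R 1 \<or> R 2 \<or> R 3" for R :: "3 \<Rightarrow> bool"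
        by (metis exhaust_3)
      ultimately show ?thesis by (auto simp: forall_3)
    qed
    then obtain i where "y $ i = x $ i + 1 \<or> x $ i = y $ i + 1" "\<And>l. l \<noteq> i \<Longrightarrow> x $ l = y $ l"
      by blast
    then have "y = x + unit_vec i \<or> x = y + unit_vec i"
      by (auto simp: vec_eq_iff axis_def)
    then show ?thesis by blast
  qed
  then show "\<exists>x i. e = lattice_edge x i"
    unfolding lattice_edge_def e(1) by (metis insert_commute)
next
  assume "\<exists>x i. e = lattice_edge x i"
  then obtain x i where e: "e = {x, x + unit_vec i}" by (auto simp: lattice_edge_def)
  have "(\<Sum>l\<in>UNIV. \<bar>x $ l - (x + unit_vec i) $ l\<bar>) = 1"
    using exhaust_3[of i] by (auto simp: sum_3 axis_def)
  then show "e \<in> lattice_edges" unfolding lattice_edges_def e by blast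
qed

lemma lattice_edge_in_lattice_edges [simp]: "lattice_edge x i \<in> lattice_edges"
  using lattice_edges_iff by blast

lemma square_edges_subset: "square_edges z i j \<subseteq> lattice_edges"
  by (auto simp: square_edges_def)

lemma share_square_imp_lattice_edge: "share_square e f \<Longrightarrow> e \<in> lattice_edges"
  unfolding share_square_def using square_edges_subset by blast

section \<open>1-connected plaquettes are dual to edges on a common square\<close>

lemma plaquette_of_lattice_edge:
  "plaquette_of (lattice_edge x i) =
     {p. p $ i = of_int (x $ i) + 1/2 \<and> (\<forall>l. l \<noteq> i \<longrightarrow> \<bar>p $ l - of_int (x $ l)\<bar> \<le> 1/2)}"
proof -
  define c where "c = midpoint (real_point x) (real_point (x + unit_vec i))"
  have c: "c $ i = of_int (x $ i) + 1/2" "\<And>l. l \<noteq> i \<Longrightarrow> c $ l = of_int (x $ l)"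
    by (auto simp: c_def midpoint_def real_point_def axis_def)
  have "plaquette_with_middle (axis_square i c) c"
    unfolding plaquette_with_middle_iff half_odd_def using c by auto
  then have "axis_square i c \<in> plaquettes" "crosses_middle (lattice_edge x i) (axis_square i c)"
    unfolding plaquettes_def crosses_middle_def lattice_edge_def c_def
    using midpoint_in_closed_segment by blast+
  then have "plaquette_of (lattice_edge x i) = axis_square i c"
    unfolding plaquette_of_def
    by (intro the1_equality plaquette_of_ex1 conjI lattice_edge_in_lattice_edges)
  then show ?thesis unfolding axis_square_def by (auto simp: c)
qed

lemma plaquette_of_lattice_edge_inject:
  assumes "plaquette_of (lattice_edge x i) = plaquette_of (lattice_edge y j)"
  shows "x = y \<and> i = j"
proof -
  \<comment> \<open>The middle of the first plaquette determines the edge: its only coordinate that is not an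
    integer gives the direction.\<close>
  define p :: "real^3" where "p = (\<chi> l. of_int (x $ l) + (if l = i then 1/2 else 0))"
  have "p \<in> plaquette_of (lattice_edge x i)"
    by (auto simp: plaquette_of_lattice_edge p_def)
  then have "p \<in> plaquette_of (lattice_edge y j)" by (simp only: assms)
  then have p: "p $ j = of_int (y $ j) + 1/2"
      "\<And>l. l \<noteq> j \<Longrightarrow> \<bar>p $ l - of_int (y $ l)\<bar> \<le> 1/2"
    unfolding plaquette_of_lattice_edge by auto
  have ij: "i = j"
  proof (rule ccontr)
    assume "i \<noteq> j"
    then have "real_of_int (x $ j) = of_int (y $ j) + 1/2" using p(1) by (simp add: p_def)
    then show False using half_odd_not_Ints[of "of_int (x $ j)"] unfolding half_odd_def
      by (metis Ints_of_int)
  qed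
  have "x $ l = y $ l" for l
  proof (cases "l = j")
    case True
    then show ?thesis using p(1) ij by (simp add: p_def)
  next
    case False
    then have "\<bar>real_of_int (x $ l) - of_int (y $ l)\<bar> \<le> 1/2"
      using p(2)[OF False] ij by (simp add: p_def)
    then show ?thesis by linarith
  qed
  then show ?thesis using ij by (simp add: vec_eq_iff)
qed

lemma inj_on_plaquette_of: "inj_on plaquette_of lattice_edges"
  by (auto simp: inj_on_def lattice_edges_iff dest!: plaquette_of_lattice_edge_inject)

text \<open>A set homeomorphic to \<open>[0,1]\<close> has two different points \<open>p\<close> and \<open>q\<close>.  A coordinate \<open>k\<close> in which
  they differ must be tangential to both plaquettes, so the two edges agree in it; that the
  plaquettes meet at all bounds the offset in the other two coordinates.\<close>

lemma one_connected_imp_share_square: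
  assumes "one_connected (plaquette_of (lattice_edge x m)) (plaquette_of (lattice_edge y n))"
  shows "share_square (lattice_edge x m) (lattice_edge y n)"
proof -
  let ?I = "plaquette_of (lattice_edge x m) \<inter> plaquette_of (lattice_edge y n)"
  from assms have hom: "?I homeomorphic {0..1::real}"
    and ne: "lattice_edge x m \<noteq> lattice_edge y n"
    by (auto simp: one_connected_def)
  obtain a b where ab: "homeomorphism ?I {0..1::real} a b"
    using hom unfolding homeomorphic_def by blast
  then have "b 0 \<in> ?I" "b 1 \<in> ?I" "b 0 \<noteq> b 1"
    unfolding homeomorphism_def by (auto, metis atLeastAtMost_iff order.refl zero_le_one zero_neq_one)
  then obtain p q where pq: "p \<in> ?I" "q \<in> ?I" "p \<noteq> q" by blast
  then obtain k where k: "p $ k \<noteq> q $ k" by (auto simp: vec_eq_iff)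
  have P: "p $ m = of_int (x $ m) + 1/2" "\<And>l. l \<noteq> m \<Longrightarrow> \<bar>p $ l - of_int (x $ l)\<bar> \<le> 1/2"
     "p $ n = of_int (y $ n) + 1/2" "\<And>l. l \<noteq> n \<Longrightarrow> \<bar>p $ l - of_int (y $ l)\<bar> \<le> 1/2"
    using pq(1) by (auto simp: plaquette_of_lattice_edge)
  have Q: "q $ m = of_int (x $ m) + 1/2" "\<And>l. l \<noteq> m \<Longrightarrow> \<bar>q $ l - of_int (x $ l)\<bar> \<le> 1/2"
     "q $ n = of_int (y $ n) + 1/2" "\<And>l. l \<noteq> n \<Longrightarrow> \<bar>q $ l - of_int (y $ l)\<bar> \<le> 1/2"
    using pq(2) by (auto simp: plaquette_of_lattice_edge)
  have km: "k \<noteq> m" "k \<noteq> n" using k P Q by auto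
  have xk: "x $ k = y $ k"
    using k P(2)[of k] P(4)[of k] Q(2)[of k] Q(4)[of k] km by linarith
  show ?thesis
  proof (cases "m = n")
    case True
    obtain i where i: "k \<noteq> i" "m \<noteq> i" using third_index[OF km(1)] .
    have iN: "i \<noteq> m" "i \<noteq> n" using i True by auto
    have all: "(\<forall>l. R l) \<longleftrightarrow> R k \<and> R m \<and> R i" for R
      using all_3_distinct[of k m i R] km i by auto
    have xm: "x $ m = y $ m" using P(1,3) True by simp
    have "x $ i \<noteq> y $ i"
    proof
      assume "x $ i = y $ i"
      then have "x = y" unfolding vec_eq_iff all using xm xk by auto
      then show False using ne True by simp
    qed
    then have "y $ i = x $ i + 1 \<or> x $ i = y $ i + 1"
      using P(2)[of i] P(4)[of i] iN by linarith
    then have "y = x + unit_vec i \<or> x = y + unit_vec i"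
      unfolding vec_eq_iff all using i km xm xk by (auto simp: axis_def)
    then show ?thesis
      unfolding share_square_def square_edges_def using i True by blast
  next
    case False
    have all: "(\<forall>l. R l) \<longleftrightarrow> R k \<and> R m \<and> R n" for R
      using all_3_distinct[of k m n R] km False by auto
    have "y $ m = x $ m \<or> y $ m = x $ m + 1"
      using P(1) P(4)[OF False] by linarith
    moreover have "x $ n = y $ n \<or> x $ n = y $ n + 1"
      using P(3) P(2)[of n] not_sym[OF False] by linarith
    ultimately have
      "y = x \<or> y = x + unit_vec m \<or> x = y + unit_vec n \<or> x + unit_vec m = y + unit_vec n"
      unfolding vec_eq_iff all using km False xk by (auto simp: axis_def)
    then consider "y = x" | "y = x + unit_vec m" | "x = y + unit_vec n"
      | "x + unit_vec m = y + unit_vec n" by blast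
    then show ?thesis
    proof cases
      case 4
      \<comment> \<open>Here the base corner of the common square lies on neither edge.\<close>
      then have "x = (x - unit_vec n) + unit_vec n" "y = (x - unit_vec n) + unit_vec m"
        by (auto simp: algebra_simps)
      then show ?thesis
        unfolding share_square_def square_edges_def using False by (metis insertCI)
    qed (use False in \<open>unfold share_square_def square_edges_def, blast+\<close>)
  qed
qed

text \<open>The four plaquettes dual to the edges of a square are arranged around the unit segment that
  pierces the centre of the square, like the blades of a paddle wheel around its axle.\<close>

lemma square_plaquettes_Int:
  assumes "i \<noteq> j" "i \<noteq> k" "j \<noteq> k"
    and "e \<in> square_edges z i j" "f \<in> square_edges z i j" "e \<noteq> f"
  shows "plaquette_of e \<inter> plaquette_of f =
    {p. p $ i = of_int (z $ i) + 1/2 \<and> p $ j = of_int (z $ j) + 1/2 \<and>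
        \<bar>p $ k - of_int (z $ k)\<bar> \<le> 1/2}"
proof -
  have all: "(\<forall>l. R l) \<longleftrightarrow> R i \<and> R j \<and> R k" for R
    using all_3_distinct assms by auto
  note [simp] = plaquette_of_lattice_edge all axis_def assms(1-3) assms(1-3)[symmetric]
  have iff:
    "p \<in> plaquette_of (lattice_edge z i) \<longleftrightarrow>
       p $ i = of_int (z $ i) + 1/2 \<and> \<bar>p $ j - of_int (z $ j)\<bar> \<le> 1/2 \<and> \<bar>p $ k - of_int (z $ k)\<bar> \<le> 1/2"
    "p \<in> plaquette_of (lattice_edge z j) \<longleftrightarrow>
       p $ j = of_int (z $ j) + 1/2 \<and> \<bar>p $ i - of_int (z $ i)\<bar> \<le> 1/2 \<and> \<bar>p $ k - of_int (z $ k)\<bar> \<le> 1/2"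
    "p \<in> plaquette_of (lattice_edge (z + unit_vec i) j) \<longleftrightarrow>
       p $ j = of_int (z $ j) + 1/2 \<and> \<bar>p $ i - (of_int (z $ i) + 1)\<bar> \<le> 1/2 \<and> \<bar>p $ k - of_int (z $ k)\<bar> \<le> 1/2"
    "p \<in> plaquette_of (lattice_edge (z + unit_vec j) i) \<longleftrightarrow>
       p $ i = of_int (z $ i) + 1/2 \<and> \<bar>p $ j - (of_int (z $ j) + 1)\<bar> \<le> 1/2 \<and> \<bar>p $ k - of_int (z $ k)\<bar> \<le> 1/2"
    for p
    by simp_all
  have "p \<in> plaquette_of e \<inter> plaquette_of f \<longleftrightarrow> p $ i = of_int (z $ i) + 1/2 \<and>
      p $ j = of_int (z $ j) + 1/2 \<and> \<bar>p $ k - of_int (z $ k)\<bar> \<le> 1/2" for p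
    using assms(4-6) unfolding square_edges_def insert_iff empty_iff
    by (elim disjE) (simp_all only: iff Int_iff simp_thms abs_le_iff, argo+)
  then show ?thesis by blast
qed

lemma share_square_imp_one_connected:
  assumes "share_square e f" "e \<noteq> f"
  shows "one_connected (plaquette_of e) (plaquette_of f)"
proof -
  obtain z i j where z: "i \<noteq> j" "e \<in> square_edges z i j" "f \<in> square_edges z i j"
    using assms unfolding share_square_def by blast
  obtain k where k: "i \<noteq> k" "j \<noteq> k" using third_index[OF z(1)] .
  have all: "(\<forall>l. R l) \<longleftrightarrow> R i \<and> R j \<and> R k" for R
    using all_3_distinct z(1) k by auto
  define a b :: "real^3"
    where "a = (\<chi> l. of_int (z $ l) + (if l = k then - (1/2) else 1/2))"
      and "b = (\<chi> l. of_int (z $ l) + 1/2)"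
  have "a \<noteq> b" by (auto simp: a_def b_def vec_eq_iff)
  have "plaquette_of e \<inter> plaquette_of f = closed_segment a b"
    unfolding square_plaquettes_Int[OF z(1) k z(2,3) assms(2)]
  proof (intro set_eqI iffI)
    fix p :: "real^3" assume "p \<in> {p. p $ i = of_int (z $ i) + 1/2 \<and> p $ j = of_int (z $ j) + 1/2 \<and>
        \<bar>p $ k - of_int (z $ k)\<bar> \<le> 1/2}"
    then show "p \<in> closed_segment a b"
      unfolding closed_segment_def mem_Collect_eq vec_eq_iff all abs_le_iff using k
      by (intro exI[of _ "p $ k - of_int (z $ k) + 1/2"]) (auto simp: a_def b_def field_simps)
  next
    fix p :: "real^3" assume "p \<in> closed_segment a b"
    then show "p \<in> {p. p $ i = of_int (z $ i) + 1/2 \<and> p $ j = of_int (z $ j) + 1/2 \<and>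
        \<bar>p $ k - of_int (z $ k)\<bar> \<le> 1/2}"
      unfolding closed_segment_def mem_Collect_eq vec_eq_iff all abs_le_iff using k
      by (auto simp: a_def b_def field_simps)
  qed
  moreover have "closed_segment a b homeomorphic {0..1::real}"
    using homeomorphic_arc_image_interval[OF arc_linepath[OF \<open>a \<noteq> b\<close>], of 0 1] by simp
  moreover have "e \<in> lattice_edges" "f \<in> lattice_edges"
    using z square_edges_subset by blast+
  ultimately show ?thesis
    unfolding one_connected_def
    using plaquette_of(1) inj_onD[OF inj_on_plaquette_of, of e f] assms(2) by auto
qed

lemma one_connected_plaquette_of_iff:
  assumes "e \<in> lattice_edges" "f \<in> lattice_edges"
  shows "one_connected (plaquette_of e) (plaquette_of f) \<longleftrightarrow> e \<noteq> f \<and> share_square e f"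
proof
  assume *: "one_connected (plaquette_of e) (plaquette_of f)"
  obtain x i y j where ef: "e = lattice_edge x i" "f = lattice_edge y j"
    using assms unfolding lattice_edges_iff by (elim exE)
  have "share_square e f"
    using * unfolding ef by (rule one_connected_imp_share_square)
  moreover have "e \<noteq> f" using * unfolding one_connected_def by blast
  ultimately show "e \<noteq> f \<and> share_square e f" by blast
next
  assume "e \<noteq> f \<and> share_square e f"
  then show "one_connected (plaquette_of e) (plaquette_of f)"
    by (intro share_square_imp_one_connected) simp_all
qed

section \<open>Closed 1-cochains on the lattice are exact\<close>

lemma int_antidifference_exists:
  fixes a :: "int \<Rightarrow> 'a::ab_group_add"
  shows "\<exists>s. \<forall>n. s (n + 1) = s n + a n"
proof (intro exI allI)
  fix n :: int
  let ?s = "\<lambda>n. if n \<ge> 0 then (\<Sum>t\<in>{0..<n}. a t) else - (\<Sum>t\<in>{n..<0}. a t)"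
  consider "n \<ge> 0" | "n = -1" | "n < -1" by linarith
  then show "?s (n + 1) = ?s n + a n"
  proof cases
    case 1
    then have "{0..<n+1} = insert n {0..<n}" by auto
    then show ?thesis using 1 by (simp add: add.commute)
  next
    case 2
    then have "{n..<0} = {n}" by auto
    then show ?thesis using 2 by simp
  next
    case 3
    then have "{n..<0} = insert n {n+1..<0}" by auto
    then show ?thesis using 3 by simp
  qed
qed

text \<open>A discrete Poincare lemma.  The potential is built one direction at a time.  If \<open>g\<close> already
  has the right increments in the directions of \<open>S\<close>, then by closedness the defect \<open>\<psi>\<close> of \<open>g\<close> in a
  further direction \<open>k\<close> is invariant under shifts in the directions of \<open>S\<close>.  Summing \<open>\<psi>\<close> along the
  lines in direction \<open>k\<close> gives a correction \<open>G\<close> with the same invariance, which thus repairs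
  direction \<open>k\<close> and leaves the directions of \<open>S\<close> intact.\<close>

lemma closed_lattice_cochain_exact:
  fixes \<phi> :: "'n::finite \<Rightarrow> int ^ 'n \<Rightarrow> 'a::ab_group_add"
  assumes closed: "\<And>i j x. \<phi> i x + \<phi> j (x + unit_vec i) = \<phi> j x + \<phi> i (x + unit_vec j)"
  obtains g where "\<And>i x. g (x + unit_vec i) = g x + \<phi> i x"
proof -
  have "\<exists>g. \<forall>i\<in>S. \<forall>x. g (x + unit_vec i) = g x + \<phi> i x" if "finite S" for S
    using that
  proof induction
    case empty
    show ?case by simp
  next
    case (insert k S)
    then obtain g where g: "\<And>i x. i \<in> S \<Longrightarrow> g (x + unit_vec i) = g x + \<phi> i x" by blast
    define \<psi> where "\<psi> x = \<phi> k x - (g (x + unit_vec k) - g x)" for x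
    have inv: "\<psi> (x + unit_vec i) = \<psi> x" if "i \<in> S" for i x
    proof -
      have "g (x + unit_vec i + unit_vec k) = g (x + unit_vec k) + \<phi> i (x + unit_vec k)"
        using g[OF that, of "x + unit_vec k"] by (simp add: add_ac)
      then show ?thesis
        using closed[of i x k] g[OF that, of x]
        unfolding \<psi>_def by (simp add: algebra_simps)
    qed
    \<comment> \<open>\<open>slide x\<close> parametrises the line through \<open>x\<close> in direction \<open>k\<close>, independently of which of its
      points \<open>x\<close> is; therefore the antidifferences chosen at different points of a line agree.\<close>
    define slide :: "int^'n \<Rightarrow> int \<Rightarrow> int^'n"
      where "slide x t = (\<chi> l. if l = k then t else x $ l)" for x t
    have slide_i: "slide (x + unit_vec i) t = slide x t + unit_vec i" if "i \<noteq> k" for x i t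
      using that by (auto simp: slide_def vec_eq_iff axis_def)
    have slide_k: "slide (x + unit_vec k) = slide x" for x
      by (auto simp: slide_def vec_eq_iff axis_def fun_eq_iff)
    define anti where "anti a = (SOME s. \<forall>n. s (n + 1) = s n + a n)" for a :: "int \<Rightarrow> 'a"
    have anti: "anti a (n + 1) = anti a n + a n" for a n
      using someI_ex[OF int_antidifference_exists[of a]] unfolding anti_def by blast
    define G where "G x = anti (\<lambda>t. \<psi> (slide x t)) (x $ k)" for x
    have "G (x + unit_vec k) = G x + \<psi> x" for x
    proof -
      have "slide x (x $ k) = x" by (auto simp: slide_def vec_eq_iff)
      then show ?thesis unfolding G_def slide_k by (simp add: anti)
    qed
    moreover have "G (x + unit_vec i) = G x" if "i \<in> S" for i x
    proof -
      have "i \<noteq> k" using that insert by auto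
      then show ?thesis by (simp add: G_def slide_i inv that) (simp add: axis_def)
    qed
    ultimately have "\<forall>i\<in>insert k S. \<forall>x. g (x + unit_vec i) + G (x + unit_vec i) = g x + G x + \<phi> i x"
      using g by (auto simp: \<psi>_def algebra_simps)
    then show ?case by (intro exI[of _ "\<lambda>x. g x + G x"])
  qed
  then show ?thesis using that by (meson finite UNIV_I)
qed

section \<open>The boundary graph in terms of squares\<close>

lemma Delta_v_in_D_or_shares_square:
  assumes D: "D \<subseteq> lattice_edges" and v: "v \<in> Delta_v D C"
  obtains d e where "d \<in> D" "e = d \<or> share_square e d" "v \<in> e"
proof -
  obtain w where w: "{v, w} \<in> lattice_edges"
      "plaquette_of {v, w} \<in> plaquette_closure (plaquette_of ` D)"
    using v unfolding Delta_v_def by blast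
  from w(2) show ?thesis
    unfolding plaquette_closure_def
  proof (elim UnE)
    assume "plaquette_of {v, w} \<in> plaquette_of ` D"
    then have "{v, w} \<in> D"
      using inj_on_image_mem_iff[OF inj_on_plaquette_of w(1) D] by blast
    then show ?thesis using that[of "{v, w}" "{v, w}"] by simp
  next
    assume "plaquette_of {v, w} \<in> {h \<in> plaquettes. \<exists>h'\<in>plaquette_of ` D. one_connected h h'}"
    then obtain d where "d \<in> D" "one_connected (plaquette_of {v, w}) (plaquette_of d)" by blast
    moreover from this have "share_square {v, w} d"
      using one_connected_plaquette_of_iff w(1) D by (meson subsetD)
    ultimately show ?thesis using that[of d "{v, w}"] by simp
  qed
qed

lemma edge_sharing_square_in_Delta_e:
  assumes D: "D \<subseteq> lattice_edges" "d \<in> D" and f: "f \<notin> D" "f \<subseteq> C" "share_square f d"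
  shows "f \<in> Delta_e D C"
proof -
  have fe: "f \<in> lattice_edges"
    using f(3) square_edges_subset unfolding share_square_def by blast
  have "one_connected (plaquette_of f) (plaquette_of d)"
    using share_square_imp_one_connected f D by blast
  then have "plaquette_of f \<in> plaquette_closure (plaquette_of ` D)"
    unfolding plaquette_closure_def one_connected_def using D(2) by blast
  moreover have "plaquette_of f \<notin> plaquette_of ` D"
    using inj_on_image_mem_iff[OF inj_on_plaquette_of fe D(1)] f(1) by blast
  ultimately show ?thesis using fe f unfolding Delta_e_def by blast
qed

section \<open>Functions that are invariant along edges or squares\<close>

lemma component_edge_closed:
  assumes "C \<in> graph_components UNIV E" "{x, y} \<in> E"
  shows "x \<in> C \<longleftrightarrow> y \<in> C"
proof -
  have "(x, y) \<in> adj_rel UNIV E" "(y, x) \<in> adj_rel UNIV E"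
    using assms(2) by (auto simp: adj_rel_def insert_commute)
  moreover obtain r where "C = {z. (r, z) \<in> (adj_rel UNIV E)\<^sup>*}"
    using assms(1) unfolding graph_components_def by blast
  ultimately show ?thesis by (metis mem_Collect_eq rtrancl.rtrancl_into_rtrancl)
qed

lemma edge_invariant_const_on_component:
  assumes C: "C \<in> graph_components UNIV E"
    and inv: "\<And>x y. {x, y} \<in> E \<Longrightarrow> x \<in> C \<Longrightarrow> y \<in> C \<Longrightarrow> F x = F y"
    and xy: "x \<in> C" "y \<in> C"
  shows "F x = F y"
proof -
  obtain r where r: "C = {y. (r, y) \<in> (adj_rel UNIV E)\<^sup>*}"
    using C unfolding graph_components_def by blast
  have "F r = F z" if "(r, z) \<in> (adj_rel UNIV E)\<^sup>*" for z
    using that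
  proof induction
    case (step u w)
    then have "{u, w} \<in> E" "u \<in> C" "w \<in> C"
      unfolding r by (auto simp: adj_rel_def intro: rtrancl_into_rtrancl)
    then show ?case using inv step.IH by metis
  qed simp
  then show ?thesis using xy unfolding r by (metis mem_Collect_eq)
qed

text \<open>Consecutive plaquettes of a chain in \<open>\<delta>\<close> are dual to edges of a common square, so the value
  of \<open>g\<close> is handed on along the chain.\<close>

lemma square_invariant_const_on_one_connected:
  assumes D: "D \<subseteq> lattice_edges" "one_connected_set (plaquette_of ` D)"
    and inv: "\<And>d e x y. d \<in> D \<Longrightarrow> e = d \<or> share_square e d \<Longrightarrow> x \<in> d \<Longrightarrow> y \<in> e \<Longrightarrow> g x = g y"
    and d: "d \<in> D" "d' \<in> D" "x \<in> d" "y \<in> d'"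
  shows "g x = g y"
proof -
  let ?R = "adj_rel (plaquette_of ` D) {{h1, h2} | h1 h2. one_connected h1 h2}"
  have "(plaquette_of d, plaquette_of d') \<in> ?R\<^sup>*"
    using D(2) d unfolding one_connected_set_def connected_graph_def by blast
  moreover have "\<forall>e\<in>D. h = plaquette_of e \<longrightarrow> (\<forall>y\<in>e. g x = g y)"
    if "(plaquette_of d, h) \<in> ?R\<^sup>*" for h
    using that
  proof induction
    case base
    have "e = d" if "e \<in> D" "plaquette_of d = plaquette_of e" for e
      using inj_onD[OF inj_on_plaquette_of that(2)] that(1) d(1) D(1) by blast
    then show ?case using inv[OF d(1) _ d(3)] by blast
  next
    case (step h h')
    then obtain e where e: "e \<in> D" "h = plaquette_of e" by (auto simp: adj_rel_def)
    have hh: "one_connected h h' \<or> one_connected h' h"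
      using step.hyps(2) by (auto simp: adj_rel_def doubleton_eq_iff)
    show ?case
    proof (intro ballI impI)
      fix f y assume f: "f \<in> D" "h' = plaquette_of f" "y \<in> f"
      have "e \<in> lattice_edges" "f \<in> lattice_edges" using e f D(1) by auto
      then have "share_square f e"
        using hh one_connected_plaquette_of_iff share_square_commute unfolding e(2) f(2) by metis
      moreover obtain u where u: "u \<in> e"
        using e(1) D(1) unfolding lattice_edges_def by blast
      ultimately have "g u = g y" using inv[OF e(1), of f u y] f(3) by blast
      moreover have "g x = g u" using step.IH e u by blast
      ultimately show "g x = g y" by simp
    qed
  qed
  ultimately show ?thesis using d by blast
qed

lemma edge_invariant_const_on_square:
  assumes inv: "\<And>a u u'. a \<in> square_edges z i j \<Longrightarrow> u \<in> a \<Longrightarrow> u' \<in> a \<Longrightarrow> g u = g u'"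
    and "d \<in> square_edges z i j" "x \<in> d" "e \<in> square_edges z i j" "y \<in> e"
  shows "g x = g y"
proof -
  have "g (z + unit_vec i) = g z" "g (z + unit_vec j) = g z"
    "g (z + unit_vec i + unit_vec j) = g (z + unit_vec i)"
    using inv[of "lattice_edge z i"] inv[of "lattice_edge z j"] inv[of "lattice_edge (z + unit_vec i) j"]
    by (simp_all add: square_edges_def lattice_edge_def)
  then have "g u = g z" if "a \<in> square_edges z i j" "u \<in> a" for a u
    using that unfolding square_edges_def lattice_edge_def by (auto simp: add_ac)
  then show ?thesis using assms(2-5) by metis
qed

section \<open>Connectedness of the boundary graph\<close>

theorem proposition6:
  fixes D :: "(int ^ 3) set set" and C :: "(int ^ 3) set"
  assumes "D \<subseteq> lattice_edges"
    and "one_connected_set (plaquette_of ` D)"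
    and "C \<in> graph_components UNIV (lattice_edges - D)"
    and "finite C"
  shows "connected_graph (Delta_v D C) (Delta_e D C)"
  unfolding connected_graph_def
proof (intro ballI)
  fix v w assume v: "v \<in> Delta_v D C" and w: "w \<in> Delta_v D C"
  let ?R = "adj_rel (Delta_v D C) (Delta_e D C)"
  define f :: "int ^ 3 \<Rightarrow> int" where "f x = of_bool ((v, x) \<in> ?R\<^sup>*)" for x
  have f_Delta_e: "f x = f y" if "{x, y} \<in> Delta_e D C" for x y
  proof -
    have "(x, y) \<in> ?R" "(y, x) \<in> ?R"
      using that Delta_e_endpoints[OF that] by (auto simp: adj_rel_def insert_commute)
    then have "(v, x) \<in> ?R\<^sup>* \<longleftrightarrow> (v, y) \<in> ?R\<^sup>*" by (meson rtrancl_into_rtrancl)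
    then show ?thesis by (simp add: f_def)
  qed
  define \<phi> where "\<phi> i x = (if lattice_edge x i \<subseteq> C \<and> lattice_edge x i \<notin> D
      then f (x + unit_vec i) - f x else 0)" for i x
  \<comment> \<open>Edges of \<open>C\<close> on a square with an edge of \<open>D\<close> are in \<open>\<Delta>\<^sub>e C\<close>, so \<open>f\<close> is constant along them.\<close>
  have near_D: "\<phi> i x = 0" if "d \<in> D" "lattice_edge x i = d \<or> share_square (lattice_edge x i) d" for i x d
  proof (cases "lattice_edge x i \<subseteq> C \<and> lattice_edge x i \<notin> D")
    case True
    then have "lattice_edge x i \<in> Delta_e D C"
      using that by (intro edge_sharing_square_in_Delta_e[OF assms(1) that(1)]) auto
    then show ?thesis using f_Delta_e by (simp add: \<phi>_def lattice_edge_def)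
  qed (simp only: \<phi>_def if_False)
  have closed: "\<phi> i x + \<phi> j (x + unit_vec i) = \<phi> j x + \<phi> i (x + unit_vec j)" for i j x
  proof -
    consider "i = j" | d where "i \<noteq> j" "d \<in> D" "d \<in> square_edges x i j"
      | "square_edges x i j \<inter> D = {}" by blast
    then show ?thesis
    proof cases
      case 2
      have "share_square e d" if "e \<in> square_edges x i j" for e
        unfolding share_square_def using that 2 by (intro exI conjI)
      then have "\<phi> i x = 0" "\<phi> j x = 0" "\<phi> j (x + unit_vec i) = 0" "\<phi> i (x + unit_vec j) = 0"
        using near_D[OF 2(2)] by (simp_all add: square_edges_def)
      then show ?thesis by simp
    next
      case 3
      have C_iff: "y \<in> C \<longleftrightarrow> y + unit_vec l \<in> C" and "lattice_edge y l \<notin> D"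
        if "lattice_edge y l \<in> square_edges x i j" for y l
      proof -
        show "lattice_edge y l \<notin> D" using 3 that by blast
        then show "y \<in> C \<longleftrightarrow> y + unit_vec l \<in> C"
          by (intro component_edge_closed[OF assms(3)])
            (use lattice_edge_in_lattice_edges in \<open>auto simp: lattice_edge_def\<close>)
      qed
      then have "\<phi> l y = (if y \<in> C then f (y + unit_vec l) - f y else 0)"
        if "lattice_edge y l \<in> square_edges x i j" for y l
        using that by (simp add: \<phi>_def) (auto simp: lattice_edge_def)
      then have "\<phi> i x = (if x \<in> C then f (x + unit_vec i) - f x else 0)"
        "\<phi> j (x + unit_vec i) = (if x \<in> C then f (x + unit_vec i + unit_vec j) - f (x + unit_vec i) else 0)"
        "\<phi> j x = (if x \<in> C then f (x + unit_vec j) - f x else 0)"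
        "\<phi> i (x + unit_vec j) = (if x \<in> C then f (x + unit_vec j + unit_vec i) - f (x + unit_vec j) else 0)"
        using C_iff[of x i] C_iff[of x j] by (simp_all add: square_edges_def)
      then show ?thesis by (simp add: add_ac)
    qed simp
  qed
  obtain g where g: "\<And>i x. g (x + unit_vec i) = g x + \<phi> i x"
    using closed_lattice_cochain_exact[of \<phi>, OF closed] by blast
  have g_edge: "g x = g y" if "d \<in> D" "e = d \<or> share_square e d" "x \<in> e" "y \<in> e" for d e x y
  proof -
    have "e \<in> lattice_edges"
      using that(1,2) assms(1) share_square_imp_lattice_edge by blast
    then obtain z i where e: "e = lattice_edge z i" unfolding lattice_edges_iff by (elim exE)
    then have "\<phi> i z = 0" using near_D that(1,2) by blast
    then have "g (z + unit_vec i) = g z" using g[of z i] by simp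
    then show ?thesis using that(3,4) unfolding e lattice_edge_def by auto
  qed
  have g_near: "g x = g y" if d: "d \<in> D" "e = d \<or> share_square e d" "x \<in> d" "y \<in> e" for d e x y
    using d(2)
  proof
    assume "e = d"
    then show ?thesis using g_edge[OF d(1), of d x y] d(3,4) by simp
  next
    assume "share_square e d"
    then obtain z i j where z: "i \<noteq> j" "e \<in> square_edges z i j" "d \<in> square_edges z i j"
      unfolding share_square_def by (elim exE conjE)
    have sh: "share_square a d" if "a \<in> square_edges z i j" for a
      unfolding share_square_def using that z by (intro exI conjI)
    show ?thesis
    proof (rule edge_invariant_const_on_square[OF _ z(3) d(3) z(2) d(4)])
      show "g u = g u'" if "a \<in> square_edges z i j" "u \<in> a" "u' \<in> a" for a u u'
        using g_edge[OF d(1) disjI2[OF sh[OF that(1)]] that(2,3)] .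
    qed
  qed
  have "g v = g w"
  proof -
    obtain d e d' e' where *: "d \<in> D" "e = d \<or> share_square e d" "v \<in> e"
       "d' \<in> D" "e' = d' \<or> share_square e' d'" "w \<in> e'"
      using Delta_v_in_D_or_shares_square[OF assms(1)] v w by metis
    obtain x y where xy: "x \<in> d" "y \<in> d'"
      using *(1,4) assms(1) unfolding lattice_edges_def by blast
    have "g x = g v" "g y = g w"
      using g_near[OF *(1,2) xy(1) *(3)] g_near[OF *(4,5) xy(2) *(6)] .
    moreover have "g x = g y"
    proof (rule square_invariant_const_on_one_connected[OF assms(1,2) _ *(1,4) xy])
      show "g x = g y" if "d \<in> D" "e = d \<or> share_square e d" "x \<in> d" "y \<in> e" for d e x y
        using g_near[OF that] .
    qed
    ultimately show ?thesis by simp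
  qed
  moreover have "g v - f v = g w - f w"
  proof (rule edge_invariant_const_on_component[OF assms(3), of "\<lambda>x. g x - f x"])
    fix x y assume xy: "{x, y} \<in> lattice_edges - D" "x \<in> C" "y \<in> C"
    then have "{x, y} \<in> lattice_edges" by blast
    then obtain z i where e: "{x, y} = lattice_edge z i" unfolding lattice_edges_iff by (elim exE)
    then have "lattice_edge z i \<subseteq> C \<and> lattice_edge z i \<notin> D" using xy by auto
    then have "\<phi> i z = f (z + unit_vec i) - f z" unfolding \<phi>_def by (rule if_P)
    then have "g (z + unit_vec i) - f (z + unit_vec i) = g z - f z"
      using g[of z i] by simp
    then show "g x - f x = g y - f y"
      using e by (auto simp: lattice_edge_def doubleton_eq_iff)
  qed (use v w in \<open>auto simp: Delta_v_def\<close>)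
  ultimately have "f w = f v" by simp
  then show "(v, w) \<in> ?R\<^sup>*" by (simp add: f_def)
qed

end
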